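(* Let $\boldsymbol\Xi$ be a splitting measure. Then the set of $\alpha>0$ such that $(\boldsymbol\Xi;\alpha)$ is $G$-growing (for some family $G$) is either empty, or an interval of the form $(0,\alpha_c)$ or $(0,\alpha_c]$ for some $\alpha_c=\alpha_c(\boldsymbol\Xi)>0$.
   Context: **Splitting measures.** $\mathcal E$ is the set of sequences $\mathbf y=(y_0,y_1,y_2,\dots)$ with $y_0>0$, $y_1\ge y_2\ge\cdots\ge0$, $y_i\to0$, with the topology induced by the supremum norm. A splitting measure is a (possibly infinite) Borel measure $\boldsymbol\Xi$ on $\mathcal E$ such that, $\Xi_0$ denoting its image by $\mathbf y\mapsto y_0$, one has $\int(1\wedge(\log y_0)^2)\,\Xi_0(\mathrm dy_0)<\infty$, $\boldsymbol\Xi(\{y_1>\varepsilon\})<\infty$ for all $\varepsilon>0$, and (standing assumption) $\int(y_0-1)^2\,\Xi_0(\mathrm dy_0)<\infty$. **Growing.** For $\alpha>0$, $(\boldsymbol\Xi;\alpha)$ is growing if there are a measurable $\mathcal E_0\subset\mathcal E$ with $\boldsymbol\Xi(\mathcal E\setminus\mathcal E_0)=0$ and a family $G=(G_x:x>0)$ of mappings $\mathcal E\to\mathcal E$ such that: (1) Semi-group property: $G_1$ is the identity and $G_x\circ G_{x'}=G_{x\cdot x'}$ for all $x,x'>0$; (2) Quasi-preservation of the measure: $\int_{\mathcal E}\phi(G_x(\mathbf y))\,\boldsymbol\Xi(\mathrm d\mathbf y)=x^{-\alpha}\int_{\mathcal E}\phi(\mathbf y)\,\boldsymbol\Xi(\mathrm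 d\mathbf y)$ for all $x>0$ and all continuous bounded $\phi:\mathcal E\to\mathbb R_+$; (3) Monotonicity: for each $\mathbf y\in\mathcal E_0$, the map $x\mapsto x\cdot G_x(\mathbf y)$ is increasing coordinate-wise (in the non-strict sense), so that in particular $x\cdot G_x(\mathbf y)\le\mathbf y$ for all $x\in(0,1]$; (4) Regularity of $G$: $(x,\mathbf y)\mapsto G_x(\mathbf y)$ is continuous from $(0,\infty)\times\mathcal E_0$ to $\mathcal E_0$ when $\mathcal E_0\subset\mathbb R_+^{\mathbb N}$ is equipped with the product topology; moreover, $G^{(0)}$ being the first coordinate (the one with index $0$) of $G$, for every compact $K\subset(0,\infty)$ there is $C_K>0$ such that for all $x,x'\in K$, $\int_{\mathcal E}\big(x(G_x^{(0)}(\mathbf y)-1)-x'(G_{x'}^{(0)}(\mathbf y)-1)\big)^2\boldsymbol\Xi(\mathrm d\mathbf y)\le C_K\,(x-x')^2$. When $(\boldsymbol\Xi;\alpha)$ is growing for a specific family $G$, it is called $G$-growing.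
   Formalization: Here α_c may be infinite, so the set may be all of (0,∞); a finite α_c is impossible in general, since e.g. the zero splitting measure is growing for every α>0 with G_x the identity. *)

theory Defs
  imports "HOL-Analysis.Analysis"
begin

text \<open>Sequences are functions of type \<open>nat \<Rightarrow> real\<close>. The type class topology on this type is the
  product topology; the topology of the supremum norm is introduced separately, as a metric
  topology on \<open>seqs\<close>.\<close>

definition seqs :: "(nat \<Rightarrow> real) set" where
  "seqs = {y. 0 < y 0 \<and> (\<forall>i\<ge>1. y (Suc i) \<le> y i) \<and> (\<forall>i. 0 \<le> y i) \<and> y \<longlonglongrightarrow> 0}"

text \<open>The value 0 outside \<open>seqs\<close> is irrelevant; it only makes the distance total and nonnegative,
  as \<^locale>\<open>Metric_space\<close> requires.\<close>

definition sup_dist :: "(nat \<Rightarrow> real) \<Rightarrow> (nat \<Rightarrow> real) \<Rightarrow> real" where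
  "sup_dist y z = (if y \<in> seqs \<and> z \<in> seqs then (SUP i. \<bar>y i - z i\<bar>) else 0)"

lemma abs_le_sup_dist:
  assumes "y \<in> seqs" "z \<in> seqs"
  shows "\<bar>y i - z i\<bar> \<le> sup_dist y z"
proof -
  have "(\<lambda>i. \<bar>y i - z i\<bar>) \<longlonglongrightarrow> \<bar>0 - 0\<bar>"
    using assms by (intro tendsto_intros) (auto simp: seqs_def)
  then have "Bseq (\<lambda>i. \<bar>y i - z i\<bar>)"
    by (intro convergent_imp_Bseq) (auto simp: convergent_def)
  then have "bdd_above (range (\<lambda>i. \<bar>y i - z i\<bar>))"
    by (rule Bseq_bdd_above)
  then show ?thesis
    using assms by (auto simp: sup_dist_def intro: cSUP_upper)
qed

lemma Metric_space_seqs: "Metric_space seqs sup_dist"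
proof
  show "0 \<le> sup_dist y z" for y z
  proof (cases "y \<in> seqs \<and> z \<in> seqs")
    case True
    then show ?thesis using abs_le_sup_dist[of y z 0] by linarith
  qed (auto simp: sup_dist_def)
  show "sup_dist y z = sup_dist z y" for y z
    by (simp add: sup_dist_def abs_minus_commute)
  show "sup_dist y z = 0 \<longleftrightarrow> y = z" if "y \<in> seqs" "z \<in> seqs" for y z
  proof
    assume "sup_dist y z = 0"
    then have "y i = z i" for i
      using abs_le_sup_dist[OF that, of i] by simp
    then show "y = z" by blast
  qed (auto simp: sup_dist_def)
  show "sup_dist x z \<le> sup_dist x y + sup_dist y z"
    if "x \<in> seqs" "y \<in> seqs" "z \<in> seqs" for x y z
  proof -
    have "(SUP i. \<bar>x i - z i\<bar>) \<le> sup_dist x y + sup_dist y z"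
    proof (rule cSUP_least)
      show "\<bar>x i - z i\<bar> \<le> sup_dist x y + sup_dist y z" for i
        using abs_le_sup_dist[of x y i] abs_le_sup_dist[of y z i] that by linarith
    qed simp
    then show ?thesis using that by (simp add: sup_dist_def)
  qed
qed

definition sup_topology :: "(nat \<Rightarrow> real) topology" where
  "sup_topology = Metric_space.mtopology seqs sup_dist"

definition seqs_borel :: "(nat \<Rightarrow> real) measure" where
  "seqs_borel = sigma seqs {U. openin sup_topology U}"

lemma measurable_coordinate: "(\<lambda>y. y i) \<in> borel_measurable seqs_borel"
proof -
  interpret Metric_space seqs sup_dist by (rule Metric_space_seqs)
  have sub: "{U. openin sup_topology U} \<subseteq> Pow seqs"
    using openin_subset[of sup_topology] by (auto simp: sup_topology_def)
  have sp: "space seqs_borel = seqs"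
    unfolding seqs_borel_def using sub by (rule space_measure_of)
  have "{y \<in> seqs. a < y i} \<in> sets seqs_borel" for a
  proof -
    have "openin mtopology {y \<in> seqs. a < y i}"
      unfolding openin_mtopology
    proof safe
      fix y assume y: "y \<in> seqs" "a < y i"
      have "mball y (y i - a) \<subseteq> {y \<in> seqs. a < y i}"
      proof safe
        fix z assume "z \<in> mball y (y i - a)"
        then show "z \<in> seqs" "a < z i"
          using abs_le_sup_dist[of y z i] by (auto simp: in_mball)
      qed
      then show "\<exists>r>0. mball y r \<subseteq> {y \<in> seqs. a < y i}"
        using y by (intro exI[of _ "y i - a"]) auto
    qed
    then show ?thesis
      unfolding seqs_borel_def using sub by (auto simp: sup_topology_def)
  qed
  then show ?thesis
    by (intro borel_measurableI_greater) (auto simp: sp)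
qed

definition splitting_measure :: "(nat \<Rightarrow> real) measure \<Rightarrow> bool" where
  "splitting_measure \<Xi> \<longleftrightarrow>
     sets \<Xi> = sets seqs_borel \<and>
     (let \<Xi>0 = distr \<Xi> borel (\<lambda>y. y 0) in
        (\<integral>\<^sup>+ t. ennreal (min 1 ((ln t)\<^sup>2)) \<partial>\<Xi>0) < \<infinity> \<and>
        (\<integral>\<^sup>+ t. ennreal ((t - 1)\<^sup>2) \<partial>\<Xi>0) < \<infinity>) \<and>
     (\<forall>\<epsilon>>0. emeasure \<Xi> {y \<in> seqs. y 1 > \<epsilon>} < \<infinity>)"

text \<open>In the continuity clause, \<^const>\<open>continuous_on\<close> refers to the product topology on
  \<open>nat \<Rightarrow> real\<close>.\<close>

definition growing_for ::
  "(nat \<Rightarrow> real) measure \<Rightarrow> real \<Rightarrow> (real \<Rightarrow> (nat \<Rightarrow> real) \<Rightarrow> (nat \<Rightarrow> real)) \<Rightarrow> bool" where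
  "growing_for \<Xi> \<alpha> G \<longleftrightarrow>
     (\<forall>x>0. G x \<in> seqs \<rightarrow> seqs) \<and>
     (\<forall>y\<in>seqs. G 1 y = y) \<and>
     (\<forall>x>0. \<forall>x'>0. \<forall>y\<in>seqs. G x (G x' y) = G (x * x') y) \<and>
     (\<forall>x>0. \<forall>\<phi>. continuous_map sup_topology euclideanreal \<phi> \<and> (\<forall>y\<in>seqs. 0 \<le> \<phi> y) \<and>
          bounded (\<phi> ` seqs) \<longrightarrow>
        (\<integral>\<^sup>+ y. ennreal (\<phi> (G x y)) \<partial>\<Xi>) = ennreal (x powr (-\<alpha>)) * (\<integral>\<^sup>+ y. ennreal (\<phi> y) \<partial>\<Xi>)) \<and>
     (\<exists>E0\<in>sets seqs_borel. emeasure \<Xi> (seqs - E0) = 0 \<and>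
        (\<forall>y\<in>E0. \<forall>i. mono_on {0<..} (\<lambda>x. x * G x y i)) \<and>
        (\<forall>x>0. G x \<in> E0 \<rightarrow> E0) \<and>
        continuous_on ({0<..} \<times> E0) (\<lambda>(x, y). G x y)) \<and>
     (\<forall>K. compact K \<and> K \<subseteq> {0<..} \<longrightarrow>
        (\<exists>C>0. \<forall>x\<in>K. \<forall>x'\<in>K.
           (\<integral>\<^sup>+ y. ennreal ((x * (G x y 0 - 1) - x' * (G x' y 0 - 1))\<^sup>2) \<partial>\<Xi>)
             \<le> ennreal (C * (x - x')\<^sup>2)))"

definition growing :: "(nat \<Rightarrow> real) measure \<Rightarrow> real \<Rightarrow> bool" where
  "growing \<Xi> \<alpha> \<longleftrightarrow> (\<exists>G. growing_for \<Xi> \<alpha> G)"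

end

theory Submission
  imports Defs
begin

text \<open>
  The exponents \<open>\<alpha> > 0\<close> for which \<open>(\<Xi>; \<alpha>)\<close> is growing form a downward closed set, and such a set
  of positive reals is empty or an interval with left end point 0.

  Downward closure comes from a change of time. If \<open>G\<close> works for \<open>\<alpha>\<close> and \<open>0 < c \<le> 1\<close>, then
  \<open>x \<mapsto> G (x powr c)\<close> works for \<open>c * \<alpha>\<close>: the map \<open>x \<mapsto> x powr c\<close> is a continuous automorphism of the
  multiplicative group \<open>(0,\<infinity>)\<close>, so the semigroup property and continuity are inherited, while the
  factor \<open>x powr (-\<alpha>)\<close> becomes \<open>x powr (-c * \<alpha>)\<close>. The condition \<open>c \<le> 1\<close> enters through monotonicity:
  \<open>x * G (x powr c) y i = x powr (1 - c) * (x powr c * G (x powr c) y i)\<close> is a product of two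
  nonnegative increasing functions of \<open>x\<close>.

  The quadratic estimate uses the same factorisation. With \<open>u t y = t * (G t y 0 - 1)\<close>, the function
  to be controlled is \<open>x powr (1 - c) * u (x powr c)\<close>, a real factor Lipschitz on compacts times a
  curve which is Lipschitz on compacts as a map into \<open>L\<^sup>2(\<Xi>)\<close>. Such a product is again Lipschitz on
  compacts if the curve is bounded there in \<open>L\<^sup>2(\<Xi>)\<close>, and it is because \<open>u 1 y = y 0 - 1\<close> is square
  integrable for a splitting measure.
\<close>

section \<open>Powers on compact sets of positive reals\<close>

text \<open>The hull of \<open>K\<close> is a compact interval away from 0, on which the derivative of the power is
  bounded.\<close>

lemma powr_lipschitz_on_compact:
  fixes K :: "real set"
  assumes "compact K" "K \<subseteq> {0<..}"
  shows "\<exists>L>0. \<forall>x\<in>K. \<forall>y\<in>K. \<bar>x powr p - y powr p\<bar> \<le> L * \<bar>x - y\<bar>"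
proof (cases "K = {}")
  case True
  then show ?thesis by (intro exI[of _ 1]) auto
next
  case False
  obtain a where a: "a \<in> K" "\<And>x. x \<in> K \<Longrightarrow> a \<le> x"
    using compact_attains_inf[OF assms(1) False] by blast
  obtain b where b: "b \<in> K" "\<And>x. x \<in> K \<Longrightarrow> x \<le> b"
    using compact_attains_sup[OF assms(1) False] by blast
  have "0 < a" using a(1) assms(2) by auto
  have "continuous_on {a..b} (\<lambda>x. p * x powr (p - 1))"
    using \<open>0 < a\<close> by (intro continuous_intros) auto
  then have "bounded ((\<lambda>x. p * x powr (p - 1)) ` {a..b})"
    by (intro compact_imp_bounded compact_continuous_image) auto
  then obtain L where L: "0 < L" "\<And>x. x \<in> {a..b} \<Longrightarrow> \<bar>p * x powr (p - 1)\<bar> \<le> L"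
    by (auto simp: bounded_pos)
  have "\<bar>x powr p - y powr p\<bar> \<le> L * \<bar>x - y\<bar>" if "x \<in> K" "y \<in> K" for x y
  proof -
    have "norm (x powr p - y powr p) \<le> L * norm (x - y)"
    proof (rule field_differentiable_bound)
      show "((\<lambda>x. x powr p) has_field_derivative p * z powr (p - 1)) (at z within {a..b})"
        if "z \<in> {a..b}" for z
        using that \<open>0 < a\<close> has_real_derivative_powr[of z p]
        by (auto intro: has_field_derivative_at_within)
    qed (use that a b L in auto)
    then show ?thesis by simp
  qed
  with L(1) show ?thesis by blast
qed

lemma compact_image_powr:
  fixes K :: "real set"
  assumes "compact K" "K \<subseteq> {0<..}"
  shows "compact ((\<lambda>x. x powr p) ` K)"
  using assms by (intro compact_continuous_image continuous_intros) auto

section \<open>Square integrability along the flow\<close>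

text \<open>For sequences, the sigma-algebra of the supremum norm contains that of the product topology, so
  functions continuous in the latter are measurable.\<close>

lemma measurable_product_continuous:
  fixes \<Xi> :: "(nat \<Rightarrow> real) measure" and f :: "(nat \<Rightarrow> real) \<Rightarrow> 'b::topological_space"
  assumes sets: "sets \<Xi> = sets seqs_borel" and "continuous_on E f"
  shows "f \<in> borel_measurable (restrict_space \<Xi> E)"
proof -
  have "(\<lambda>y. y) \<in> measurable \<Xi> borel"
    using measurable_coordinate
    by (intro measurable_coordinatewise_then_product) (simp add: measurable_cong_sets[OF sets refl])
  then have "(\<lambda>y. y) \<in> measurable (restrict_space \<Xi> E) (restrict_space borel E)"
    by (rule measurable_restrict_space3) auto
  from measurable_compose[OF this borel_measurable_continuous_on_restrict[OF assms(2)]]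
  show ?thesis .
qed

lemma splitting_measure_square_integrable:
  assumes "splitting_measure \<Xi>"
  shows "(\<integral>\<^sup>+ y. ennreal ((y 0 - 1)\<^sup>2) \<partial>\<Xi>) < \<infinity>"
proof -
  have "(\<lambda>y. y 0) \<in> borel_measurable \<Xi>"
    using assms measurable_coordinate[of 0]
    by (simp add: splitting_measure_def cong: measurable_cong_sets)
  then have "(\<integral>\<^sup>+ t. ennreal ((t - 1)\<^sup>2) \<partial>distr \<Xi> borel (\<lambda>y. y 0)) = (\<integral>\<^sup>+ y. ennreal ((y 0 - 1)\<^sup>2) \<partial>\<Xi>)"
    by (intro nn_integral_distr) auto
  then show ?thesis using assms by (simp add: splitting_measure_def Let_def)
qed

lemma nn_integral_square_combination_le:
  fixes f g :: "'a \<Rightarrow> real"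
  assumes [measurable]: "f \<in> borel_measurable M" "g \<in> borel_measurable M"
  shows "(\<integral>\<^sup>+ y. ennreal ((a * f y + b * g y)\<^sup>2) \<partial>M) \<le>
    ennreal (2 * a\<^sup>2) * (\<integral>\<^sup>+ y. ennreal ((f y)\<^sup>2) \<partial>M) + ennreal (2 * b\<^sup>2) * (\<integral>\<^sup>+ y. ennreal ((g y)\<^sup>2) \<partial>M)"
proof -
  have "(s + t)\<^sup>2 \<le> 2 * s\<^sup>2 + 2 * t\<^sup>2" for s t :: real
    using sum_squares_bound[of s t] by (simp add: power2_sum)
  then have "(a * f y + b * g y)\<^sup>2 \<le> 2 * a\<^sup>2 * (f y)\<^sup>2 + 2 * b\<^sup>2 * (g y)\<^sup>2" for y
    by (metis power_mult_distrib mult.assoc)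
  then have "(\<integral>\<^sup>+ y. ennreal ((a * f y + b * g y)\<^sup>2) \<partial>M) \<le>
      (\<integral>\<^sup>+ y. ennreal (2 * a\<^sup>2) * ennreal ((f y)\<^sup>2) + ennreal (2 * b\<^sup>2) * ennreal ((g y)\<^sup>2) \<partial>M)"
    by (intro nn_integral_mono) (simp flip: ennreal_mult ennreal_plus)
  also have "\<dots> = ennreal (2 * a\<^sup>2) * (\<integral>\<^sup>+ y. ennreal ((f y)\<^sup>2) \<partial>M) +
      ennreal (2 * b\<^sup>2) * (\<integral>\<^sup>+ y. ennreal ((g y)\<^sup>2) \<partial>M)"
    by (simp add: nn_integral_add nn_integral_cmult)
  finally show ?thesis .
qed

text \<open>The product rule in \<open>L\<^sup>2\<close>: writing \<open>r(x) = x powr p\<close>, \<open>s = x powr q\<close> and \<open>s' = x' powr q\<close>, the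
  difference \<open>r(x) u\<^sub>s - r(x') u\<^bsub>s'\<^esub>\<close> splits as \<open>r(x) (u\<^sub>s - u\<^bsub>s'\<^esub>) + (r(x) - r(x')) u\<^bsub>s'\<^esub>\<close>. The
  second term needs a bound on \<open>u\<^bsub>s'\<^esub>\<close> uniform in \<open>s'\<close>; splitting \<open>u\<^bsub>s'\<^esub> = (u\<^bsub>s'\<^esub> - u\<^sub>1) + u\<^sub>1\<close>
  reduces it to the single time 1.\<close>

lemma square_lipschitz_powr_scaling:
  fixes u :: "real \<Rightarrow> 'a \<Rightarrow> real"
  assumes meas: "\<And>t. 0 < t \<Longrightarrow> u t \<in> borel_measurable M"
    and lip: "\<And>K. compact K \<Longrightarrow> K \<subseteq> {0<..} \<Longrightarrow> \<exists>C>0. \<forall>s\<in>K. \<forall>t\<in>K.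
      (\<integral>\<^sup>+ y. ennreal ((u s y - u t y)\<^sup>2) \<partial>M) \<le> ennreal (C * (s - t)\<^sup>2)"
    and fin: "(\<integral>\<^sup>+ y. ennreal ((u 1 y)\<^sup>2) \<partial>M) < \<infinity>"
    and K: "compact K" "K \<subseteq> {0<..}"
  shows "\<exists>C>0. \<forall>x\<in>K. \<forall>x'\<in>K.
    (\<integral>\<^sup>+ y. ennreal ((x powr p * u (x powr q) y - x' powr p * u (x' powr q) y)\<^sup>2) \<partial>M)
      \<le> ennreal (C * (x - x')\<^sup>2)"
proof -
  define J where "J = insert 1 ((\<lambda>x. x powr q) ` K)"
  have J: "compact J" "J \<subseteq> {0<..}"
    using compact_image_powr[OF K] K(2) by (auto simp: J_def)
  obtain C where C: "0 < C" "\<And>s t. s \<in> J \<Longrightarrow> t \<in> J \<Longrightarrow>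
      (\<integral>\<^sup>+ y. ennreal ((u s y - u t y)\<^sup>2) \<partial>M) \<le> ennreal (C * (s - t)\<^sup>2)"
    using lip[OF J] by blast
  obtain Lp where Lp: "0 < Lp"
      "\<And>x x'. x \<in> K \<Longrightarrow> x' \<in> K \<Longrightarrow> \<bar>x powr p - x' powr p\<bar> \<le> Lp * \<bar>x - x'\<bar>"
    using powr_lipschitz_on_compact[OF K] by blast
  obtain Lq where Lq: "0 < Lq"
      "\<And>x x'. x \<in> K \<Longrightarrow> x' \<in> K \<Longrightarrow> \<bar>x powr q - x' powr q\<bar> \<le> Lq * \<bar>x - x'\<bar>"
    using powr_lipschitz_on_compact[OF K] by blast
  obtain B where B: "0 < B" "\<And>x. x \<in> K \<Longrightarrow> \<bar>x powr p\<bar> \<le> B"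
    using compact_imp_bounded[OF compact_image_powr[OF K, of p]] by (auto simp: bounded_pos)
  obtain T where T: "\<And>t. t \<in> J \<Longrightarrow> \<bar>t\<bar> \<le> T"
    using compact_imp_bounded[OF J(1)] by (auto simp: bounded_pos)
  obtain I where I: "0 \<le> I" "(\<integral>\<^sup>+ y. ennreal ((u 1 y)\<^sup>2) \<partial>M) = ennreal I"
    using fin by (auto simp: less_top_ennreal)
  define D where "D = 2 * (C * (T + 1)\<^sup>2) + 2 * I"
  have "0 \<le> D" using C(1) I(1) by (simp add: D_def)
  have D: "(\<integral>\<^sup>+ y. ennreal ((u t y)\<^sup>2) \<partial>M) \<le> ennreal D" if "t \<in> J" for t
  proof -
    have [measurable]: "u t \<in> borel_measurable M" "u 1 \<in> borel_measurable M"
      using meas that J(2) by auto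
    have "\<bar>t - 1\<bar> \<le> T + 1" using T[OF that] by linarith
    then have "(t - 1)\<^sup>2 \<le> (T + 1)\<^sup>2" by (rule abs_le_square_iff[THEN iffD1, OF order_trans]) simp
    then have diff: "(\<integral>\<^sup>+ y. ennreal ((u t y - u 1 y)\<^sup>2) \<partial>M) \<le> ennreal (C * (T + 1)\<^sup>2)"
      using C(1) by (intro order_trans[OF C(2)[OF that]] ennreal_leI) (auto simp: J_def)
    have "(\<integral>\<^sup>+ y. ennreal ((u t y)\<^sup>2) \<partial>M) \<le>
        ennreal 2 * (\<integral>\<^sup>+ y. ennreal ((u t y - u 1 y)\<^sup>2) \<partial>M) + ennreal 2 * (\<integral>\<^sup>+ y. ennreal ((u 1 y)\<^sup>2) \<partial>M)"
      using nn_integral_square_combination_le[of "\<lambda>y. u t y - u 1 y" M "u 1" 1 1] by simp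
    also have "\<dots> \<le> ennreal 2 * ennreal (C * (T + 1)\<^sup>2) + ennreal 2 * ennreal I"
      unfolding I(2) by (intro add_mono mult_left_mono diff) auto
    also have "\<dots> = ennreal D"
      using C(1) I(1) by (simp add: D_def del: ennreal_numeral flip: ennreal_mult ennreal_plus)
    finally show ?thesis .
  qed
  define C' where "C' = 2 * B\<^sup>2 * (C * Lq\<^sup>2) + 2 * Lp\<^sup>2 * D"
  have "0 < C'" using B(1) C(1) Lq(1) \<open>0 \<le> D\<close> by (simp add: C'_def add_pos_nonneg)
  moreover have "(\<integral>\<^sup>+ y. ennreal ((x powr p * u (x powr q) y - x' powr p * u (x' powr q) y)\<^sup>2) \<partial>M)
      \<le> ennreal (C' * (x - x')\<^sup>2)" if x: "x \<in> K" "x' \<in> K" for x x'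
  proof -
    define s s' where "s = x powr q" and "s' = x' powr q"
    have s: "s \<in> J" "s' \<in> J" using x by (auto simp: J_def s_def s'_def)
    have [measurable]: "u s \<in> borel_measurable M" "u s' \<in> borel_measurable M"
      using meas s J(2) by auto
    have "\<bar>s - s'\<bar> \<le> \<bar>Lq * (x - x')\<bar>" "\<bar>x powr p - x' powr p\<bar> \<le> \<bar>Lp * (x - x')\<bar>"
      using Lq Lp x by (auto simp: s_def s'_def abs_mult)
    then have sq: "(s - s')\<^sup>2 \<le> Lq\<^sup>2 * (x - x')\<^sup>2" "(x powr p - x' powr p)\<^sup>2 \<le> Lp\<^sup>2 * (x - x')\<^sup>2"
      by (simp_all add: abs_le_square_iff power_mult_distrib)
    have r: "(x powr p)\<^sup>2 \<le> B\<^sup>2" using B x by (simp add: abs_le_square_iff[symmetric])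
    have "x powr p * u s y - x' powr p * u s' y =
        x powr p * (u s y - u s' y) + (x powr p - x' powr p) * u s' y" for y
      by (simp add: algebra_simps)
    then have "(\<integral>\<^sup>+ y. ennreal ((x powr p * u s y - x' powr p * u s' y)\<^sup>2) \<partial>M) \<le>
        ennreal (2 * (x powr p)\<^sup>2) * (\<integral>\<^sup>+ y. ennreal ((u s y - u s' y)\<^sup>2) \<partial>M) +
        ennreal (2 * (x powr p - x' powr p)\<^sup>2) * (\<integral>\<^sup>+ y. ennreal ((u s' y)\<^sup>2) \<partial>M)"
      using nn_integral_square_combination_le[of "\<lambda>y. u s y - u s' y" M "u s'"] by simp
    also have "\<dots> \<le> ennreal (2 * B\<^sup>2) * ennreal (C * (Lq\<^sup>2 * (x - x')\<^sup>2)) +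
        ennreal (2 * (Lp\<^sup>2 * (x - x')\<^sup>2)) * ennreal D"
      using sq r C(1)
      by (intro add_mono mult_mono order_trans[OF C(2)[OF s]] D s ennreal_leI mult_left_mono) auto
    also have "\<dots> = ennreal (C' * (x - x')\<^sup>2)"
      using C(1) \<open>0 \<le> D\<close> by (simp add: C'_def algebra_simps flip: ennreal_mult ennreal_plus)
    finally show ?thesis by (simp add: s_def s'_def)
  qed
  ultimately show ?thesis by blast
qed

section \<open>Change of time\<close>

text \<open>The exponent \<open>1 - c\<close> left over from \<open>x = x powr (1 - c) * x powr c\<close> has to be nonnegative for
  monotonicity, hence \<open>c \<le> 1\<close>. The quadratic estimate is proved on \<open>E\<^sub>0\<close> with the restricted measure:
  continuity there is what makes \<open>G x\<close> measurable, and the complement is null.\<close>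

lemma growing_for_powr_time_change:
  assumes split: "splitting_measure \<Xi>" and grow: "growing_for \<Xi> \<alpha> G" and c: "0 < c" "c \<le> 1"
  shows "growing_for \<Xi> (c * \<alpha>) (\<lambda>x. G (x powr c))"
proof -
  have sets: "sets \<Xi> = sets seqs_borel"
    using split by (simp add: splitting_measure_def)
  have space_Xi: "space \<Xi> = seqs"
  proof -
    have "{U. openin sup_topology U} \<subseteq> Pow seqs"
      using openin_subset[of sup_topology] Metric_space.topspace_mtopology[OF Metric_space_seqs]
      by (auto simp: sup_topology_def)
    then show ?thesis
      by (simp add: sets_eq_imp_space_eq[OF sets] seqs_borel_def space_measure_of)
  qed
  note G_props = grow[unfolded growing_for_def]
  note G_seqs = G_props[THEN conjunct1, rule_format]
    and G_one = G_props[THEN conjunct2, THEN conjunct1, rule_format]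
    and G_comp = G_props[THEN conjunct2, THEN conjunct2, THEN conjunct1, rule_format]
  note G_props' = G_props[THEN conjunct2, THEN conjunct2, THEN conjunct2]
  note G_int = G_props'[THEN conjunct1, rule_format]
    and G_E0_props = G_props'[THEN conjunct2, THEN conjunct1]
    and G_lip = G_props'[THEN conjunct2, THEN conjunct2, rule_format]
  obtain E0 where E0: "E0 \<in> sets seqs_borel" "emeasure \<Xi> (seqs - E0) = 0"
    and G_mono: "\<And>y i. y \<in> E0 \<Longrightarrow> mono_on {0<..} (\<lambda>x. x * G x y i)"
    and G_E0: "\<And>x. 0 < x \<Longrightarrow> G x \<in> E0 \<rightarrow> E0"
    and G_cont: "continuous_on ({0<..} \<times> E0) (\<lambda>(x, y). G x y)"
    using G_E0_props by blast
  have E0_seqs: "E0 \<subseteq> seqs"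
    using sets.sets_into_space[of E0 \<Xi>] E0(1) by (simp add: sets space_Xi)

  have mono: "mono_on {0<..} (\<lambda>x. x * G (x powr c) y i)" if y: "y \<in> E0" for y i
  proof (rule mono_onI)
    fix r s :: real assume rs: "r \<in> {0<..}" "s \<in> {0<..}" "r \<le> s"
    have factor: "x * G (x powr c) y i = x powr (1 - c) * (x powr c * G (x powr c) y i)"
      if "0 < x" for x
      using that by (simp add: powr_add[symmetric] mult.assoc[symmetric])
    have "G (r powr c) y \<in> seqs"
      using G_seqs[of "r powr c"] rs y E0_seqs by auto
    then have "0 \<le> G (r powr c) y i"
      by (simp add: seqs_def)
    moreover have "r powr c * G (r powr c) y i \<le> s powr c * G (s powr c) y i"
      using rs c by (intro mono_onD[OF G_mono[OF y]]) (auto intro: powr_mono2)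
    moreover have "r powr (1 - c) \<le> s powr (1 - c)"
      using rs c by (intro powr_mono2) auto
    ultimately have "r powr (1 - c) * (r powr c * G (r powr c) y i) \<le>
        s powr (1 - c) * (s powr c * G (s powr c) y i)"
      by (intro mult_mono[of "r powr (1 - c)"]) auto
    then show "r * G (r powr c) y i \<le> s * G (s powr c) y i"
      using rs by (simp only: factor greaterThan_iff)
  qed

  have cont: "continuous_on ({0<..} \<times> E0) (\<lambda>(x, y). G (x powr c) y)"
  proof -
    have "continuous_on ({0<..} \<times> E0) (\<lambda>z. (\<lambda>(x, y). G x y) (fst z powr c, snd z))"
    proof (rule continuous_on_compose2[OF G_cont])
      show "continuous_on ({0<..} \<times> E0) (\<lambda>z. (fst z powr c, snd z))"
        by (intro continuous_on_Pair continuous_on_powr continuous_on_fst continuous_on_snd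
            continuous_on_id continuous_on_const) auto
    qed auto
    then show ?thesis by (simp add: case_prod_unfold)
  qed

  define N where "N = restrict_space \<Xi> E0"
  have nn_integral_N: "(\<integral>\<^sup>+ y. f y \<partial>N) = (\<integral>\<^sup>+ y. f y \<partial>\<Xi>)" for f :: "(nat \<Rightarrow> real) \<Rightarrow> ennreal"
  proof -
    have "seqs - E0 \<in> sets \<Xi>"
      using sets.compl_sets[of E0 \<Xi>] E0(1) by (simp add: sets space_Xi)
    then have "AE y in \<Xi>. y \<in> E0"
      using E0(2) by (intro AE_I[of _ _ "seqs - E0"]) (auto simp: space_Xi)
    then have "(\<integral>\<^sup>+ y. f y * indicator E0 y \<partial>\<Xi>) = (\<integral>\<^sup>+ y. f y \<partial>\<Xi>)"
      by (intro nn_integral_cong_AE) (auto elim!: eventually_mono)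
    then show ?thesis
      using E0(1) by (simp add: N_def nn_integral_restrict_space sets)
  qed
  define u where "u t y = t * (G t y 0 - 1)" for t y
  have "\<exists>C>0. \<forall>x\<in>K. \<forall>x'\<in>K.
      (\<integral>\<^sup>+ y. ennreal ((x powr (1 - c) * u (x powr c) y - x' powr (1 - c) * u (x' powr c) y)\<^sup>2) \<partial>N)
        \<le> ennreal (C * (x - x')\<^sup>2)" if "compact K" "K \<subseteq> {0<..}" for K
  proof (rule square_lipschitz_powr_scaling[OF _ _ _ that])
    show "u t \<in> borel_measurable N" if "0 < t" for t
    proof -
      have "continuous_on E0 (\<lambda>y. (\<lambda>(x, y). G x y) (t, y))"
        using that
        by (intro continuous_on_compose2[OF G_cont] continuous_on_Pair continuous_on_const
            continuous_on_id) auto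
      then have "continuous_on E0 (G t)"
        by simp
      then have "continuous_on E0 (\<lambda>y. G t y 0)"
        by (rule continuous_on_product_then_coordinatewise)
      then have "continuous_on E0 (u t)"
        unfolding u_def by (intro continuous_on_mult continuous_on_diff continuous_on_const)
      then show ?thesis
        unfolding N_def by (rule measurable_product_continuous[OF sets])
    qed
    show "\<exists>C>0. \<forall>s\<in>J. \<forall>t\<in>J.
        (\<integral>\<^sup>+ y. ennreal ((u s y - u t y)\<^sup>2) \<partial>N) \<le> ennreal (C * (s - t)\<^sup>2)"
      if "compact J" "J \<subseteq> {0<..}" for J
      using G_lip[of J] that by (simp add: nn_integral_N u_def)
    have "(\<integral>\<^sup>+ y. ennreal ((u 1 y)\<^sup>2) \<partial>\<Xi>) = (\<integral>\<^sup>+ y. ennreal ((y 0 - 1)\<^sup>2) \<partial>\<Xi>)"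
      by (intro nn_integral_cong) (simp add: u_def G_one space_Xi)
    then show "(\<integral>\<^sup>+ y. ennreal ((u 1 y)\<^sup>2) \<partial>N) < \<infinity>"
      using splitting_measure_square_integrable[OF split] by (simp add: nn_integral_N)
  qed
  moreover have "x powr (1 - c) * u (x powr c) y = x * (G (x powr c) y 0 - 1)" if "0 < x" for x y
    using that by (simp add: u_def powr_add[symmetric] mult.assoc[symmetric])
  ultimately have lip: "\<exists>C>0. \<forall>x\<in>K. \<forall>x'\<in>K.
      (\<integral>\<^sup>+ y. ennreal ((x * (G (x powr c) y 0 - 1) - x' * (G (x' powr c) y 0 - 1))\<^sup>2) \<partial>\<Xi>)
        \<le> ennreal (C * (x - x')\<^sup>2)" if "compact K" "K \<subseteq> {0<..}" for K
    using that by (simp add: nn_integral_N subset_iff)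

  show ?thesis
    unfolding growing_for_def
  proof (intro conjI allI impI ballI)
    show "G (x powr c) \<in> seqs \<rightarrow> seqs" if "0 < x" for x
      using G_seqs that by simp
    show "G (1 powr c) y = y" if "y \<in> seqs" for y
      using G_one that by simp
    show "G (x powr c) (G (x' powr c) y) = G ((x * x') powr c) y"
      if "0 < x" "0 < x'" "y \<in> seqs" for x x' y
      using G_comp that by (simp add: powr_mult)
    show "(\<integral>\<^sup>+ y. ennreal (\<phi> (G (x powr c) y)) \<partial>\<Xi>) =
        ennreal (x powr - (c * \<alpha>)) * (\<integral>\<^sup>+ y. ennreal (\<phi> y) \<partial>\<Xi>)"
      if "0 < x" "continuous_map sup_topology euclideanreal \<phi> \<and> (\<forall>y\<in>seqs. 0 \<le> \<phi> y) \<and>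
        bounded (\<phi> ` seqs)" for x \<phi>
      using G_int[of "x powr c" \<phi>] that by (simp add: powr_powr)
    show "\<exists>E0\<in>sets seqs_borel. emeasure \<Xi> (seqs - E0) = 0 \<and>
        (\<forall>y\<in>E0. \<forall>i. mono_on {0<..} (\<lambda>x. x * G (x powr c) y i)) \<and>
        (\<forall>x>0. G (x powr c) \<in> E0 \<rightarrow> E0) \<and>
        continuous_on ({0<..} \<times> E0) (\<lambda>(x, y). G (x powr c) y)"
      using E0 mono G_E0 cont by (intro bexI[of _ E0]) auto
  qed (use lip in blast)
qed

section \<open>The set of growing exponents\<close>

lemma growing_downward_closed:
  assumes "splitting_measure \<Xi>" "growing \<Xi> \<alpha>" "0 < \<beta>" "\<beta> \<le> \<alpha>"
  shows "growing \<Xi> \<beta>"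
proof -
  obtain G where "growing_for \<Xi> \<alpha> G"
    using assms(2) by (auto simp: growing_def)
  then have "growing_for \<Xi> (\<beta> / \<alpha> * \<alpha>) (\<lambda>x. G (x powr (\<beta> / \<alpha>)))"
    using assms by (intro growing_for_powr_time_change) auto
  then show ?thesis
    using assms by (auto simp: growing_def)
qed

text \<open>The supremum is taken in the extended reals, so that a set without upper bound is the open
  interval up to \<open>\<infinity>\<close>. Which form of interval occurs depends on whether the supremum is attained.\<close>

lemma downward_closed_positive_cases:
  fixes S :: "real set"
  assumes pos: "S \<subseteq> {0<..}" and "S \<noteq> {}"
    and down: "\<And>a b. a \<in> S \<Longrightarrow> 0 < b \<Longrightarrow> b \<le> a \<Longrightarrow> b \<in> S"
  shows "\<exists>s::ereal. 0 < s \<and> (S = {a. 0 < a \<and> ereal a < s} \<or> S = {a. 0 < a \<and> ereal a \<le> s})"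
proof -
  define s where "s = (SUP a\<in>S. ereal a)"
  have upper: "ereal a \<le> s" if "a \<in> S" for a
    unfolding s_def using that by (rule SUP_upper)
  have below: "a \<in> S" if "0 < a" "ereal a < s" for a
    using that down by (auto simp: s_def less_SUP_iff intro: less_imp_le)
  obtain a where "a \<in> S" using \<open>S \<noteq> {}\<close> by blast
  then have "0 < s"
    using pos upper[of a] by (intro less_le_trans[of 0 "ereal a" s]) auto
  moreover have "S = {a. 0 < a \<and> ereal a \<le> s}" if attained: "b \<in> S" "s = ereal b" for b
  proof (intro equalityI subsetI)
    show "a \<in> {a. 0 < a \<and> ereal a \<le> s}" if "a \<in> S" for a
      using pos upper that by auto
    show "a \<in> S" if "a \<in> {a. 0 < a \<and> ereal a \<le> s}" for a
      using that attained(2) by (auto intro!: down[OF attained(1)])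
  qed
  moreover have "S = {a. 0 < a \<and> ereal a < s}" if unattained: "\<And>b. b \<in> S \<Longrightarrow> s \<noteq> ereal b"
  proof (intro equalityI subsetI)
    show "a \<in> {a. 0 < a \<and> ereal a < s}" if "a \<in> S" for a
      using pos upper[OF that] unattained[OF that] that by (auto simp: order.strict_iff_order)
    show "a \<in> S" if "a \<in> {a. 0 < a \<and> ereal a < s}" for a
      using that below by simp
  qed
  ultimately show ?thesis by blast
qed

theorem lemma2:
  fixes \<Xi> :: "(nat \<Rightarrow> real) measure"
  assumes "splitting_measure \<Xi>"
  shows "{\<alpha>. 0 < \<alpha> \<and> growing \<Xi> \<alpha>} = {} \<or>
    (\<exists>\<alpha>\<^sub>c::ereal. 0 < \<alpha>\<^sub>c \<and>
      ({\<alpha>. 0 < \<alpha> \<and> growing \<Xi> \<alpha>} = {\<alpha>. 0 < \<alpha> \<and> ereal \<alpha> < \<alpha>\<^sub>c} \<or>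
       {\<alpha>. 0 < \<alpha> \<and> growing \<Xi> \<alpha>} = {\<alpha>. 0 < \<alpha> \<and> ereal \<alpha> \<le> \<alpha>\<^sub>c}))"
proof (cases "{\<alpha>. 0 < \<alpha> \<and> growing \<Xi> \<alpha>} = {}")
  case False
  then show ?thesis
    using growing_downward_closed[OF assms]
    by (intro disjI2 downward_closed_positive_cases) auto
qed blast

end
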